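(* The S-system $(\mathcal{M},\vec{\ltimes},\mathcal{V})$, given by the V-product action of the monoid $(\mathcal{M},\ltimes)$ of all real matrices on the set $\mathcal{V}$ of all real vectors of arbitrary finite dimension, is a pseudo dynamic system.
   Context: $\mathcal{M}_{m\times n}$: real $m\times n$ matrices, $\mathcal{M}=\bigcup_{m,n\ge1}\mathcal{M}_{m\times n}$. $\mathcal{V}=\bigcup_{n\ge1}\mathcal{V}_n$ (disjoint union), $\mathcal{V}_n=\mathbb{R}^n$ (column vectors). $\otimes$ is the Kronecker product, $\mathbf{1}_k\in\mathbb{R}^k$ the all-ones column. M-product: for $A\in\mathcal{M}_{m\times n}$, $B\in\mathcal{M}_{p\times q}$, $t=\operatorname{lcm}(n,p)$: $A\ltimes B:=(A\otimes I_{t/n})(B\otimes I_{t/p})$; identity element: the $1\times 1$ matrix $1$. V-product: for $A\in\mathcal{M}_{m\times n}$, $x\in\mathcal{V}_r$, $t=\operatorname{lcm}(n,r)$: $A\,\vec{\ltimes}\,x:=(A\otimes I_{t/n})(x\otimes\mathbf{1}_{t/r})$. Topology on $\mathcal{V}$: for $x\in\mathcal{V}_m$, $\|x\|_{\mathcal{V}}:=\sqrt{\tfrac1m x^Tx}$; for $x\in\mathcal{V}_m,y\in\mathcal{V}_n$, $t=\operatorname{lcm}(m,n)$, the V-subtraction is $x\,\vec{-}\,y:=(x\otimes\mathbf{1}_{t/m})-(y\otimes\mathbf{1}_{t/n})$, and $d(x,y):=\|x\,\vec{-}\,y\|_{\mathcal{V}}$. The topology has as basis the balls $\{y: d(x,y)<r\}$,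 $x\in\mathcal{V}$, $r>0$. S-system: a triple $(S,\varphi,X)$ with $(S,* )$ a monoid with identity $e$, $X\ne\emptyset$, and $\varphi:S\times X\to X$ satisfying $\varphi(g_1,\varphi(g_2,x))=\varphi(g_1*g_2,x)$ and $\varphi(e,x)=x$. It is a pseudo dynamic system if $X$ is a topological space and for each $s\in S$ the map $x\mapsto\varphi(s,x)$ is continuous. *)

theory Defs
  imports
    "Jordan_Normal_Form.Matrix"
    "HOL-Analysis.Abstract_Topology"
    "HOL-Analysis.L2_Norm"
begin

section \<open>Kronecker products\<close>

definition kron_mat :: "'a::semiring_0 mat \<Rightarrow> 'a mat \<Rightarrow> 'a mat" (infixl \<open>\<otimes>\<^sub>m\<close> 70) where
  "A \<otimes>\<^sub>m B =
     mat (dim_row A * dim_row B) (dim_col A * dim_col B)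
       (\<lambda>(i, j). A $$ (i div dim_row B, j div dim_col B) * B $$ (i mod dim_row B, j mod dim_col B))"

definition kron_vec :: "'a::semiring_0 vec \<Rightarrow> 'a vec \<Rightarrow> 'a vec" (infixl \<open>\<otimes>\<^sub>v\<close> 70) where
  "x \<otimes>\<^sub>v y = vec (dim_vec x * dim_vec y) (\<lambda>i. x $ (i div dim_vec y) * y $ (i mod dim_vec y))"

lemma kron_vec_eq_kron_mat:
  assumes "dim_vec y > 0"
  shows "mat_of_cols (dim_vec x * dim_vec y) [x \<otimes>\<^sub>v y] =
         mat_of_cols (dim_vec x) [x] \<otimes>\<^sub>m mat_of_cols (dim_vec y) [y]"
  using assms
  by (intro eq_matI)
    (auto simp: kron_vec_def kron_mat_def mat_of_cols_def less_mult_imp_div_less)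

definition ones_vec :: "nat \<Rightarrow> 'a::one vec" where
  "ones_vec k = vec k (\<lambda>_. 1)"

section \<open>The monoid of all real matrices and its action on all real vectors\<close>

text \<open>The library types of matrices and vectors also contain objects with a zero dimension;
  the carriers exclude them.\<close>

definition all_mats :: "real mat set" where
  "all_mats = {A. dim_row A \<ge> 1 \<and> dim_col A \<ge> 1}"

definition all_vecs :: "real vec set" where
  "all_vecs = {x. dim_vec x \<ge> 1}"

definition M_product :: "real mat \<Rightarrow> real mat \<Rightarrow> real mat" where
  "M_product A B =
     (let t = lcm (dim_col A) (dim_row B)
      in (A \<otimes>\<^sub>m 1\<^sub>m (t div dim_col A)) * (B \<otimes>\<^sub>m 1\<^sub>m (t div dim_row B)))"

definition V_product :: "real mat \<Rightarrow> real vec \<Rightarrow> real vec" where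
  "V_product A x =
     (let t = lcm (dim_col A) (dim_vec x)
      in (A \<otimes>\<^sub>m 1\<^sub>m (t div dim_col A)) *\<^sub>v (x \<otimes>\<^sub>v ones_vec (t div dim_vec x)))"

definition M_monoid :: "real mat monoid" where
  "M_monoid = \<lparr>carrier = all_mats, mult = M_product, one = 1\<^sub>m 1\<rparr>"

section \<open>The topology on the space of all real vectors\<close>

definition V_norm :: "real vec \<Rightarrow> real" where
  "V_norm x = sqrt (1 / real (dim_vec x) * (x \<bullet> x))"

definition V_minus :: "real vec \<Rightarrow> real vec \<Rightarrow> real vec" where
  "V_minus x y =
     (let t = lcm (dim_vec x) (dim_vec y)
      in (x \<otimes>\<^sub>v ones_vec (t div dim_vec x)) - (y \<otimes>\<^sub>v ones_vec (t div dim_vec y)))"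

definition V_dist :: "real vec \<Rightarrow> real vec \<Rightarrow> real" where
  "V_dist x y = V_norm (V_minus x y)"

definition V_ball :: "real vec \<Rightarrow> real \<Rightarrow> real vec set" where
  "V_ball x r = {y \<in> all_vecs. V_dist x y < r}"

definition is_V_ball :: "real vec set \<Rightarrow> bool" where
  "is_V_ball B \<longleftrightarrow> (\<exists>x \<in> all_vecs. \<exists>r > 0. B = V_ball x r)"

text \<open>The open sets are the unions of balls. Since \<^const>\<open>topology\<close> is unspecified on families that
  do not form a topology, \<open>istopology_V_balls\<close> below shows that the balls are a basis.\<close>

definition V_topology :: "real vec topology" where
  "V_topology = topology (arbitrary union_of is_V_ball)"

lemma V_dist_lcm:
  fixes x y
  defines "t \<equiv> lcm (dim_vec x) (dim_vec y)"
  assumes "x \<in> all_vecs" "y \<in> all_vecs"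
  shows "V_dist x y =
    sqrt (1 / t * (\<Sum>k<t. (x $ (k div (t div dim_vec x)) - y $ (k div (t div dim_vec y)))\<^sup>2))"
proof -
  have d: "dim_vec x dvd t" "dim_vec y dvd t" and t: "t > 0"
    using assms(2,3) by (auto simp: t_def all_vecs_def intro!: lcm_pos_nat)
  have "k mod (t div dim_vec x) < t div dim_vec x" "k mod (t div dim_vec y) < t div dim_vec y" for k
    using d t by (auto intro!: mod_less_divisor simp: dvd_div_eq_0_iff)
  then show ?thesis
    using d t
    by (simp add: V_dist_def V_norm_def V_minus_def Let_def kron_vec_def ones_vec_def
        scalar_prod_def power2_eq_square atLeast0LessThan flip: t_def)
qed

lemma sum_div_const:
  fixes f :: "nat \<Rightarrow> real"
  assumes "c > 0"
  shows "(\<Sum>k<t * c. f (k div c)) = real c * (\<Sum>k<t. f k)"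
proof -
  have "(\<Sum>k<t * c. f (k div c)) = (\<Sum>m<t. \<Sum>k=m*c..<m*c+c. f (k div c))"
    by (rule sum.nat_group [symmetric])
  also have "\<dots> = (\<Sum>m<t. \<Sum>k=m*c..<m*c+c. f m)"
  proof (intro sum.cong refl)
    fix m k assume "k \<in> {m*c..<m*c+c}"
    then have "k div c = m"
      by (intro div_nat_eqI) (auto simp: algebra_simps)
    then show "f (k div c) = f m" by simp
  qed
  finally show ?thesis by (simp add: sum_distrib_left)
qed

lemma V_dist_common_multiple:
  assumes xy: "x \<in> all_vecs" "y \<in> all_vecs"
    and T: "T > 0" "dim_vec x dvd T" "dim_vec y dvd T"
  shows "V_dist x y =
    L2_set (\<lambda>k. x $ (k div (T div dim_vec x)) - y $ (k div (T div dim_vec y))) {..<T} / sqrt T"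
proof -
  define t where "t = lcm (dim_vec x) (dim_vec y)"
  obtain c where c: "T = t * c" using T unfolding t_def by (metis dvdE lcm_least)
  have d: "dim_vec x dvd t" "dim_vec y dvd t" and pos: "t > 0" "c > 0"
    using T(1) c by (auto simp: t_def)
  define f where "f k = (x $ (k div (t div dim_vec x)) - y $ (k div (t div dim_vec y)))\<^sup>2" for k
  have *: "T div dim_vec x = c * (t div dim_vec x)" "T div dim_vec y = c * (t div dim_vec y)"
    using d by (simp_all add: c div_mult_swap mult.commute)
  have "(x $ (k div (T div dim_vec x)) - y $ (k div (T div dim_vec y)))\<^sup>2 = f (k div c)" for k
    by (simp add: f_def * div_mult2_eq)
  then have "L2_set (\<lambda>k. x $ (k div (T div dim_vec x)) - y $ (k div (T div dim_vec y))) {..<T} / sqrt T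
      = sqrt ((real c * (\<Sum>k<t. f k)) / T)"
    unfolding L2_set_def using sum_div_const [OF pos(2), of f t]
    by (simp only: real_sqrt_divide flip: c)
  also have "(real c * (\<Sum>k<t. f k)) / T = 1 / t * (\<Sum>k<t. f k)"
    using pos by (simp add: c)
  finally show ?thesis
    by (simp add: V_dist_lcm [OF xy] f_def flip: t_def)
qed

lemma V_dist_self: "x \<in> all_vecs \<Longrightarrow> V_dist x x = 0"
  by (simp add: V_dist_lcm)

lemma V_dist_commute: "x \<in> all_vecs \<Longrightarrow> y \<in> all_vecs \<Longrightarrow> V_dist x y = V_dist y x"
  by (simp add: V_dist_lcm lcm.commute power2_commute)

lemma V_dist_triangle:
  assumes "x \<in> all_vecs" "y \<in> all_vecs" "z \<in> all_vecs"
  shows "V_dist x z \<le> V_dist x y + V_dist y z"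
proof -
  define T where "T = dim_vec x * dim_vec y * dim_vec z"
  have T: "T > 0" "dim_vec x dvd T" "dim_vec y dvd T" "dim_vec z dvd T"
    using assms by (auto simp: T_def all_vecs_def)
  define e where "e v k = v $ (k div (T div dim_vec v))" for v :: "real vec" and k
  have "L2_set (\<lambda>k. e x k - e z k) {..<T}
      \<le> L2_set (\<lambda>k. e x k - e y k) {..<T} + L2_set (\<lambda>k. e y k - e z k) {..<T}"
    using L2_set_triangle_ineq [of "\<lambda>k. e x k - e y k" "\<lambda>k. e y k - e z k" "{..<T}"] by simp
  then show ?thesis
    using T(1) assms
    by (simp add: V_dist_common_multiple [where T = T] T e_def divide_right_mono
        flip: add_divide_distrib)
qed

lemma istopology_V_balls: "istopology (arbitrary union_of is_V_ball)"
  unfolding istopology_base_eq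
proof (intro allI impI, elim conjE)
  fix S T assume "is_V_ball S" "is_V_ball T"
  then obtain x r y s where S: "x \<in> all_vecs" "S = V_ball x r"
    and T: "y \<in> all_vecs" "T = V_ball y s"
    by (auto simp: is_V_ball_def)
  have "\<exists>U. is_V_ball U \<and> z \<in> U \<and> U \<subseteq> S \<inter> T" if "z \<in> S \<inter> T" for z
  proof -
    have z: "z \<in> all_vecs" "V_dist x z < r" "V_dist y z < s"
      using that S T by (auto simp: V_ball_def)
    define q where "q = min (r - V_dist x z) (s - V_dist y z)"
    have "q > 0" using z by (simp add: q_def)
    then have "is_V_ball (V_ball z q)" "z \<in> V_ball z q"
      using z by (auto simp: is_V_ball_def V_ball_def V_dist_self)
    moreover have "V_ball z q \<subseteq> S \<inter> T"
    proof
      fix w assume "w \<in> V_ball z q"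
      then have "w \<in> all_vecs" "V_dist z w < q" by (auto simp: V_ball_def)
      then show "w \<in> S \<inter> T"
        using V_dist_triangle [of x z w] V_dist_triangle [of y z w] S T z
        by (auto simp: V_ball_def q_def)
    qed
    ultimately show ?thesis by blast
  qed
  then show "(arbitrary union_of is_V_ball) (S \<inter> T)"
    by (auto simp: arbitrary_union_of_alt)
qed

lemma openin_V_topology: "openin V_topology = arbitrary union_of is_V_ball"
  using istopology_V_balls by (simp add: V_topology_def topology_inverse')

section \<open>S-systems and pseudo dynamic systems\<close>

locale S_system = monoid S
  for S (structure) and act :: "'a \<Rightarrow> 'x \<Rightarrow> 'x" and X :: "'x set" +
  assumes nonempty: "X \<noteq> {}"
    and act_closed: "\<lbrakk>g \<in> carrier S; x \<in> X\<rbrakk> \<Longrightarrow> act g x \<in> X"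
    and act_mult: "\<lbrakk>g \<in> carrier S; h \<in> carrier S; x \<in> X\<rbrakk> \<Longrightarrow> act g (act h x) = act (g \<otimes> h) x"
    and act_one: "x \<in> X \<Longrightarrow> act \<one> x = x"

locale pseudo_dynamic_system = S_system S act X
  for S (structure) and act :: "'a \<Rightarrow> 'x \<Rightarrow> 'x" and X :: "'x set" and \<tau> :: "'x topology" +
  assumes topspace_eq: "topspace \<tau> = X"
    and continuous_act: "g \<in> carrier S \<Longrightarrow> continuous_map \<tau> \<tau> (act g)"

end

theory Submission
  imports Defs "HOL-Analysis.Convex"
begin

text \<open>
  Write \<open>A\<otimes>I\<^sub>k\<close> and \<open>x\<otimes>1\<^sub>k\<close> for the stretch of a matrix or vector by the factor \<open>k\<close>. Stretching is
  functorial: it respects products (\<open>stretch_mat_mult\<close>, \<open>stretch_mat_mult_vec\<close>), and consecutive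
  factors multiply (\<open>stretch_mat_stretch\<close>, \<open>stretch_vec_stretch\<close>). Both products of the theorem
  stretch their arguments by the smallest factors that make the dimensions match and then multiply
  as usual.

  Consequently each bracketing of a triple product is the ordinary product of stretched factors
  \<open>A\<otimes>I\<^sub>a\<close>, \<open>B\<otimes>I\<^sub>b\<close>, \<open>C\<otimes>I\<^sub>c\<close>, where \<open>a\<close>, \<open>b\<close>, \<open>c\<close> are the smallest factors for which both
  interfaces match. The smallest triple does not depend on the bracketing (\<open>lcm_stretch\<close>), so
  associativity, and likewise the action law, reduces to associativity of the ordinary product.

  For continuity, stretch \<open>x\<close> and \<open>y\<close> to a common dimension. The distance of \<open>x\<close> and \<open>y\<close> is the
  normalised Euclidean norm of the difference of the stretched vectors, and the difference of their
  images is obtained from it by some \<open>A\<otimes>I\<^sub>k\<close>. This matrix is, up to a permutation of coordinates, a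
  direct sum of \<open>k\<close> copies of \<open>A\<close>, so the Frobenius norm of \<open>A\<close> bounds its operator norm whatever
  \<open>k\<close> is (\<open>L2_set_stretch_mat_le\<close>). As the normalising dimensions always have the ratio of the two
  dimensions of \<open>A\<close>, the action of \<open>A\<close> is Lipschitz on vectors of all dimensions with one constant
  (\<open>V_product_lipschitz\<close>).
\<close>

section \<open>Stretching matrices and vectors\<close>

abbreviation stretch_mat :: "real mat \<Rightarrow> nat \<Rightarrow> real mat" where
  "stretch_mat A k \<equiv> A \<otimes>\<^sub>m 1\<^sub>m k"

abbreviation stretch_vec :: "real vec \<Rightarrow> nat \<Rightarrow> real vec" where
  "stretch_vec x k \<equiv> x \<otimes>\<^sub>v ones_vec k"

lemma dim_kron_mat [simp]:
  "dim_row (A \<otimes>\<^sub>m B) = dim_row A * dim_row B"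
  "dim_col (A \<otimes>\<^sub>m B) = dim_col A * dim_col B"
  by (simp_all add: kron_mat_def)

lemma dim_kron_vec [simp]: "dim_vec (x \<otimes>\<^sub>v y) = dim_vec x * dim_vec y"
  by (simp add: kron_vec_def)

lemma dim_ones_vec [simp]: "dim_vec (ones_vec k) = k"
  by (simp add: ones_vec_def)

lemma mod_less_if_less_mult: "i mod k < k" if "i < m * k" for i k m :: nat
  using that by (cases "k = 0") auto

lemma stretch_mat_index:
  assumes "i < dim_row A * k" "j < dim_col A * k"
  shows "stretch_mat A k $$ (i, j) = (if i mod k = j mod k then A $$ (i div k, j div k) else 0)"
  using assms mod_less_if_less_mult[OF assms(1)] mod_less_if_less_mult[OF assms(2)]
  by (simp add: kron_mat_def)

lemma stretch_vec_index:
  assumes "i < dim_vec x * k"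
  shows "stretch_vec x k $ i = x $ (i div k)"
  using assms mod_less_if_less_mult[OF assms] by (simp add: kron_vec_def ones_vec_def)

lemma sum_div_mod:
  fixes f :: "nat \<Rightarrow> nat \<Rightarrow> real"
  shows "(\<Sum>i<m * k. f (i div k) (i mod k)) = (\<Sum>a<m. \<Sum>b<k. f a b)"
proof -
  have block: "(\<Sum>i=a*k..<a*k+k. f (i div k) (i mod k)) = (\<Sum>b<k. f a b)" for a
  proof -
    have "(\<Sum>i=a*k..<a*k+k. f (i div k) (i mod k))
        = (\<Sum>b=0..<k. f ((b + a*k) div k) ((b + a*k) mod k))"
      using sum.shift_bounds_nat_ivl[of "\<lambda>i. f (i div k) (i mod k)" 0 "a*k" k]
      by (simp add: add.commute)
    also have "\<dots> = (\<Sum>b<k. f a b)"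
      unfolding atLeast0LessThan by (rule sum.cong) auto
    finally show ?thesis .
  qed
  show ?thesis
    by (simp add: sum.nat_group [symmetric] block)
qed

text \<open>Row \<open>i\<close> of the stretched matrix is row \<open>i div k\<close> of \<open>A\<close>, spread over the columns that are
  congruent to \<open>i\<close> modulo \<open>k\<close>.\<close>

lemma stretch_row_sum:
  fixes g :: "nat \<Rightarrow> real"
  assumes i: "i < dim_row A * k"
  shows "(\<Sum>l<dim_col A * k. stretch_mat A k $$ (i, l) * g l)
       = (\<Sum>j<dim_col A. A $$ (i div k, j) * g (j * k + i mod k))"
proof -
  let ?f = "\<lambda>a b. if b = i mod k then A $$ (i div k, a) * g (a * k + b) else 0"
  have "(\<Sum>l<dim_col A * k. stretch_mat A k $$ (i, l) * g l)
      = (\<Sum>l<dim_col A * k. ?f (l div k) (l mod k))"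
  proof (intro sum.cong refl)
    fix l assume "l \<in> {..<dim_col A * k}"
    moreover have "l = l div k * k + i mod k" if "l mod k = i mod k"
      using that by (metis div_mult_mod_eq)
    ultimately show "stretch_mat A k $$ (i, l) * g l = ?f (l div k) (l mod k)"
      using i by (auto simp: stretch_mat_index)
  qed
  also have "\<dots> = (\<Sum>a<dim_col A. \<Sum>b<k. ?f a b)"
    by (rule sum_div_mod)
  also have "\<dots> = (\<Sum>j<dim_col A. A $$ (i div k, j) * g (j * k + i mod k))"
    using mod_less_if_less_mult[OF i] by (simp add: sum.delta)
  finally show ?thesis .
qed

lemma less_mult_combine: "j * k + b < n * k" if "j < n" "b < k" for j k b n :: nat
proof -
  have "j * k + b < (j + 1) * k" using that by (simp add: algebra_simps)
  also have "\<dots> \<le> n * k" using that by (intro mult_le_mono1) simp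
  finally show ?thesis .
qed

lemma stretch_mat_mult_vec_index:
  assumes "i < dim_row A * k" "dim_vec z = dim_col A * k"
  shows "(stretch_mat A k *\<^sub>v z) $ i = (\<Sum>j<dim_col A. A $$ (i div k, j) * z $ (j * k + i mod k))"
  using assms stretch_row_sum[OF assms(1), of "\<lambda>l. z $ l"]
  by (simp add: scalar_prod_def atLeast0LessThan)

lemma stretch_mat_stretch: "stretch_mat (stretch_mat A k) l = stretch_mat A (k * l)"
proof (rule eq_matI)
  fix i j assume "i < dim_row (stretch_mat A (k * l))" "j < dim_col (stretch_mat A (k * l))"
  then have ij: "i < dim_row A * k * l" "j < dim_col A * k * l"
    by (simp_all add: mult.assoc)
  \<comment> \<open>With respect to mixed radices, \<open>i mod (k * l)\<close> has the digits \<open>i mod l\<close> and \<open>i div l mod k\<close>;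
    equal numbers have equal digits.\<close>
  have digits_eq_iff: "b + l * c = b' + l * c' \<longleftrightarrow> b = b' \<and> c = c'" if "b < l" "b' < l" for b b' c c'
  proof
    assume "b + l * c = b' + l * c'"
    then have "(b + l * c) mod l = (b' + l * c') mod l" "(b + l * c) div l = (b' + l * c') div l"
      by simp_all
    then show "b = b' \<and> c = c'" using that by simp
  qed auto
  have "i mod (k * l) = i mod l + l * (i div l mod k)" for i
    using mod_mult2_eq[of i l k] by (simp only: mult.commute add.commute)
  then have mm: "i mod (k * l) = j mod (k * l) \<longleftrightarrow> i mod l = j mod l \<and> i div l mod k = j div l mod k"
    using digits_eq_iff mod_less_if_less_mult[OF ij(1)] mod_less_if_less_mult[OF ij(2)] by (simp only:)
  show "stretch_mat (stretch_mat A k) l $$ (i, j) = stretch_mat A (k * l) $$ (i, j)"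
    using ij ij[unfolded mult.assoc] mm div_mult2_eq[of i l k] div_mult2_eq[of j l k]
    by (simp add: stretch_mat_index less_mult_imp_div_less mult.commute[of l k])
qed (simp_all add: mult.assoc)

lemma stretch_vec_stretch: "stretch_vec (stretch_vec x k) l = stretch_vec x (k * l)"
proof (rule eq_vecI)
  fix i assume i: "i < dim_vec (stretch_vec x (k * l))"
  then have "i < dim_vec x * k * l" by (simp add: mult.assoc)
  then show "stretch_vec (stretch_vec x k) l $ i = stretch_vec x (k * l) $ i"
    using i
    by (simp add: stretch_vec_index less_mult_imp_div_less div_mult2_eq mult.commute[of k l])
qed (simp add: mult.assoc)

lemma stretch_mat_1: "stretch_mat A 1 = A"
  by (rule eq_matI) (simp_all add: stretch_mat_index)

lemma stretch_vec_1: "stretch_vec x 1 = x"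
  by (rule eq_vecI) (simp_all add: stretch_vec_index)

lemma stretch_one_mat: "stretch_mat (1\<^sub>m n) k = 1\<^sub>m (n * k)"
proof (rule eq_matI)
  fix i j assume "i < dim_row (1\<^sub>m (n * k) :: real mat)" "j < dim_col (1\<^sub>m (n * k) :: real mat)"
  then have ij: "i < n * k" "j < n * k" by simp_all
  moreover have "i mod k = j mod k \<and> i div k = j div k \<longleftrightarrow> i = j"
    by (metis div_mult_mod_eq)
  ultimately show "stretch_mat (1\<^sub>m n) k $$ (i, j) = 1\<^sub>m (n * k) $$ (i, j)"
    by (auto simp: stretch_mat_index less_mult_imp_div_less)
qed simp_all

lemma stretch_mat_mult:
  assumes "dim_col A = dim_row B"
  shows "stretch_mat (A * B) k = stretch_mat A k * stretch_mat B k"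
proof (rule eq_matI)
  fix i j
  assume "i < dim_row (stretch_mat A k * stretch_mat B k)"
    and "j < dim_col (stretch_mat A k * stretch_mat B k)"
  then have ij: "i < dim_row A * k" "j < dim_col B * k" by simp_all
  note b = mod_less_if_less_mult[OF ij(1)]
  have "(stretch_mat A k * stretch_mat B k) $$ (i, j)
      = (\<Sum>l<dim_col A * k. stretch_mat A k $$ (i, l) * stretch_mat B k $$ (l, j))"
    using ij assms by (simp add: scalar_prod_def atLeast0LessThan)
  also have "\<dots> = (\<Sum>l<dim_col A. A $$ (i div k, l) * stretch_mat B k $$ (l * k + i mod k, j))"
    by (rule stretch_row_sum[OF ij(1)])
  also have "\<dots> = (\<Sum>l<dim_col A. A $$ (i div k, l) *
      (if i mod k = j mod k then B $$ (l, j div k) else 0))"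
    using ij b assms
    by (intro sum.cong refl) (simp add: stretch_mat_index less_mult_combine)
  also have "\<dots> = stretch_mat (A * B) k $$ (i, j)"
    using ij assms
    by (simp add: stretch_mat_index scalar_prod_def atLeast0LessThan less_mult_imp_div_less)
  finally show "stretch_mat (A * B) k $$ (i, j) = (stretch_mat A k * stretch_mat B k) $$ (i, j)" ..
qed simp_all

lemma stretch_mat_mult_vec:
  assumes "dim_col A = dim_vec x"
  shows "stretch_vec (A *\<^sub>v x) k = stretch_mat A k *\<^sub>v stretch_vec x k"
proof (rule eq_vecI)
  fix i assume "i < dim_vec (stretch_mat A k *\<^sub>v stretch_vec x k)"
  then have i: "i < dim_row A * k" by simp
  have "(stretch_mat A k *\<^sub>v stretch_vec x k) $ i
      = (\<Sum>j<dim_col A. A $$ (i div k, j) * stretch_vec x k $ (j * k + i mod k))"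
    using i assms by (intro stretch_mat_mult_vec_index) simp_all
  also have "\<dots> = (\<Sum>j<dim_col A. A $$ (i div k, j) * x $ j)"
    using mod_less_if_less_mult[OF i] assms
    by (intro sum.cong refl) (simp add: stretch_vec_index less_mult_combine)
  also have "\<dots> = stretch_vec (A *\<^sub>v x) k $ i"
    using i assms
    by (simp add: stretch_vec_index scalar_prod_def atLeast0LessThan less_mult_imp_div_less)
  finally show "stretch_vec (A *\<^sub>v x) k $ i = (stretch_mat A k *\<^sub>v stretch_vec x k) $ i" ..
qed simp

section \<open>Associativity\<close>

text \<open>The arithmetic behind associativity. Let \<open>n\<close>, \<open>p\<close> and \<open>q\<close>, \<open>r\<close> be the dimensions at the two
  interfaces of a triple product. Matching the first interface stretches the middle factor by a
  multiple of \<open>lcm n p div p\<close>, matching the second one by a multiple of \<open>lcm q r div q\<close>; hence \<open>c\<close>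
  is its smallest factor for both. The lemma says that matching first the left and then the right
  interface results in exactly \<open>c\<close> and in the two outer factors determined by it. Since \<open>c\<close> is
  symmetric under exchanging \<open>(n, p, q, r)\<close> with \<open>(r, q, p, n)\<close>, the lemma also covers the other
  order.\<close>

lemma lcm_stretch:
  fixes n p q r :: nat
  assumes pos: "n > 0" "p > 0" "q > 0" "r > 0"
  defines "a \<equiv> lcm n p div n" and "b \<equiv> lcm n p div p"
    and "c \<equiv> lcm (lcm n p div p) (lcm q r div q)"
  defines "u \<equiv> lcm (q * b) r"
  shows "a * (u div (q * b)) = p * c div n" "b * (u div (q * b)) = c" "u div r = q * c div r"
proof -
  have na: "n * a = lcm n p" and pb: "p * b = lcm n p"
    by (simp_all add: a_def b_def)
  have bpos: "b > 0" using pb pos by (metis lcm_pos_nat mult_is_0 neq0_conv)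
  have "u = lcm (q * b) (lcm q r)"
    by (simp add: u_def lcm.assoc [symmetric]) 
  also have "\<dots> = lcm (q * b) (q * (lcm q r div q))" by simp
  also have "\<dots> = q * c" by (simp only: lcm_mult_left c_def b_def) simp
  finally have u: "u = q * c" .
  obtain d where d: "c = b * d" unfolding c_def b_def by (meson dvd_lcm1 dvdE)
  have ud: "u div (q * b) = d" using u d bpos pos by simp
  show "b * (u div (q * b)) = c" "u div r = q * c div r" using ud d u by simp_all
  have "p * c = n * (a * d)" using d na pb by (metis mult.assoc)
  then show "a * (u div (q * b)) = p * c div n" using ud pos by simp
qed

lemma dim_M_product [simp]:
  "dim_row (M_product A B) = dim_row A * (lcm (dim_col A) (dim_row B) div dim_col A)"
  "dim_col (M_product A B) = dim_col B * (lcm (dim_col A) (dim_row B) div dim_row B)"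
  by (simp_all add: M_product_def Let_def)

lemma dim_V_product [simp]:
  "dim_vec (V_product A x) = dim_row A * (lcm (dim_col A) (dim_vec x) div dim_col A)"
  by (simp add: V_product_def Let_def)

lemma lcm_div_pos: "lcm n p div n > 0" "lcm n p div p > 0" if "n > 0" "p > 0" for n p :: nat
  using that by (simp_all add: div_greater_zero_iff dvd_imp_le lcm_pos_nat)

lemma M_product_closed: "A \<in> all_mats \<Longrightarrow> B \<in> all_mats \<Longrightarrow> M_product A B \<in> all_mats"
  using lcm_div_pos[of "dim_col A" "dim_row B"]
  by (simp add: all_mats_def Suc_le_eq)

lemma V_product_closed: "A \<in> all_mats \<Longrightarrow> x \<in> all_vecs \<Longrightarrow> V_product A x \<in> all_vecs"
  using lcm_div_pos[of "dim_col A" "dim_vec x"]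
  by (simp add: all_mats_def all_vecs_def Suc_le_eq)

lemma M_product_left_nested:
  assumes "A \<in> all_mats" "B \<in> all_mats" "C \<in> all_mats"
  defines "c \<equiv> lcm (lcm (dim_col A) (dim_row B) div dim_row B)
                   (lcm (dim_col B) (dim_row C) div dim_col B)"
  shows "M_product (M_product A B) C =
    stretch_mat A (dim_row B * c div dim_col A) * stretch_mat B c *
    stretch_mat C (dim_col B * c div dim_row C)"
proof -
  let ?n = "dim_col A" and ?p = "dim_row B" and ?q = "dim_col B" and ?r = "dim_row C"
  have pos: "?n > 0" "?p > 0" "?q > 0" "?r > 0"
    using assms by (auto simp: all_mats_def)
  note e = lcm_stretch[OF pos, folded c_def]
  show ?thesis
    using e
    by (simp add: M_product_def[of _ C] M_product_def[of A B] Let_def stretch_mat_mult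
        stretch_mat_stretch)
qed

lemma V_product_M_product:
  assumes "A \<in> all_mats" "B \<in> all_mats" "x \<in> all_vecs"
  defines "c \<equiv> lcm (lcm (dim_col A) (dim_row B) div dim_row B)
                   (lcm (dim_col B) (dim_vec x) div dim_col B)"
  shows "V_product (M_product A B) x =
    (stretch_mat A (dim_row B * c div dim_col A) * stretch_mat B c) *\<^sub>v
    stretch_vec x (dim_col B * c div dim_vec x)"
proof -
  let ?n = "dim_col A" and ?p = "dim_row B" and ?q = "dim_col B" and ?r = "dim_vec x"
  have pos: "?n > 0" "?p > 0" "?q > 0" "?r > 0"
    using assms by (auto simp: all_mats_def all_vecs_def)
  note e = lcm_stretch[OF pos, folded c_def]
  show ?thesis
    using e
    by (simp add: V_product_def[of _ x] M_product_def[of A B] Let_def stretch_mat_mult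
        stretch_mat_stretch)
qed

lemma M_product_right_nested:
  assumes "A \<in> all_mats" "B \<in> all_mats" "C \<in> all_mats"
  defines "c \<equiv> lcm (lcm (dim_col A) (dim_row B) div dim_row B)
                   (lcm (dim_col B) (dim_row C) div dim_col B)"
  shows "M_product A (M_product B C) =
    stretch_mat A (dim_row B * c div dim_col A) *
    (stretch_mat B c * stretch_mat C (dim_col B * c div dim_row C))"
proof -
  let ?n = "dim_col A" and ?p = "dim_row B" and ?q = "dim_col B" and ?r = "dim_row C"
  have pos: "?n > 0" "?p > 0" "?q > 0" "?r > 0"
    using assms by (auto simp: all_mats_def)
  have c: "lcm (lcm ?r ?q div ?q) (lcm ?p ?n div ?p) = c"
    by (simp add: c_def lcm.commute)
  \<comment> \<open>the mirror image: the right interface is matched first\<close>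
  note e = lcm_stretch[OF pos(4,3,2,1), unfolded c, unfolded lcm.commute[of ?r ?q]
      lcm.commute[of _ ?n]]
  show ?thesis
    using e
    by (simp add: M_product_def[of A] M_product_def[of B C] Let_def stretch_mat_mult
        stretch_mat_stretch)
qed

lemma V_product_V_product:
  assumes "A \<in> all_mats" "B \<in> all_mats" "x \<in> all_vecs"
  defines "c \<equiv> lcm (lcm (dim_col A) (dim_row B) div dim_row B)
                   (lcm (dim_col B) (dim_vec x) div dim_col B)"
  shows "V_product A (V_product B x) =
    stretch_mat A (dim_row B * c div dim_col A) *\<^sub>v
    (stretch_mat B c *\<^sub>v stretch_vec x (dim_col B * c div dim_vec x))"
proof -
  let ?n = "dim_col A" and ?p = "dim_row B" and ?q = "dim_col B" and ?r = "dim_vec x"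
  have pos: "?n > 0" "?p > 0" "?q > 0" "?r > 0"
    using assms by (auto simp: all_mats_def all_vecs_def)
  have c: "lcm (lcm ?r ?q div ?q) (lcm ?p ?n div ?p) = c"
    by (simp add: c_def lcm.commute)
  note e = lcm_stretch[OF pos(4,3,2,1), unfolded c, unfolded lcm.commute[of ?r ?q]
      lcm.commute[of _ ?n]]
  show ?thesis
    using e
    by (simp add: V_product_def[of A] V_product_def[of B x] Let_def stretch_mat_mult_vec
        stretch_mat_stretch stretch_vec_stretch)
qed

text \<open>The stretched factors have matching dimensions, so that the ordinary associativity laws
  apply to them.\<close>

lemma lcm_stretch_match:
  fixes n p q r :: nat
  assumes pos: "n > 0" "p > 0" "q > 0" "r > 0"
  defines "c \<equiv> lcm (lcm n p div p) (lcm q r div q)"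
  shows "n * (p * c div n) = p * c" "r * (q * c div r) = q * c"
proof -
  have "p * (lcm n p div p) dvd p * c" "q * (lcm q r div q) dvd q * c"
    unfolding c_def by (intro mult_dvd_mono dvd_refl dvd_lcm1 dvd_lcm2)+
  then have "lcm n p dvd p * c" "lcm q r dvd q * c" by simp_all
  then have "n dvd p * c" "r dvd q * c" by (meson dvd_lcm1 dvd_lcm2 dvd_trans)+
  then show "n * (p * c div n) = p * c" "r * (q * c div r) = q * c" by simp_all
qed

lemma M_product_assoc:
  assumes "A \<in> all_mats" "B \<in> all_mats" "C \<in> all_mats"
  shows "M_product (M_product A B) C = M_product A (M_product B C)"
  unfolding M_product_left_nested[OF assms] M_product_right_nested[OF assms]
  using assms
  by (intro assoc_mult_mat[OF carrier_matI[OF refl refl] carrier_matI[OF _ refl] carrier_matI[OF _ refl]])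
    (simp_all add: all_mats_def lcm_stretch_match)

lemma V_product_assoc:
  assumes "A \<in> all_mats" "B \<in> all_mats" "x \<in> all_vecs"
  shows "V_product A (V_product B x) = V_product (M_product A B) x"
  unfolding V_product_M_product[OF assms] V_product_V_product[OF assms]
  using assms
  by (intro assoc_mult_mat_vec[OF carrier_matI[OF refl refl] carrier_matI[OF _ refl] carrier_vecI, symmetric])
    (simp_all add: all_mats_def all_vecs_def lcm_stretch_match)

lemma M_product_one_left: "M_product (1\<^sub>m 1) A = A" if "A \<in> all_mats"
  using that stretch_mat_1[of A]
  by (simp add: M_product_def all_mats_def stretch_one_mat left_mult_one_mat' del: One_nat_def)

lemma M_product_one_right: "M_product A (1\<^sub>m 1) = A" if "A \<in> all_mats"
  using that stretch_mat_1[of A]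
  by (simp add: M_product_def all_mats_def stretch_one_mat right_mult_one_mat' del: One_nat_def)

lemma V_product_one: "V_product (1\<^sub>m 1) x = x" if "x \<in> all_vecs"
proof -
  have "dim_vec x div dim_vec x = 1" using that by (intro div_self) (auto simp: all_vecs_def)
  then show ?thesis
    using stretch_vec_1[of x]
    by (simp add: V_product_def Let_def stretch_one_mat one_mult_mat_vec[OF carrier_vecI]
        del: One_nat_def)
qed

section \<open>Continuity\<close>

lemma V_dist_stretch:
  assumes "x \<in> all_vecs" "y \<in> all_vecs" "dim_vec x * a = T" "dim_vec y * b = T" "T > 0"
  shows "V_dist x y = L2_set (\<lambda>k. stretch_vec x a $ k - stretch_vec y b $ k) {..<T} / sqrt T"
proof -
  have dv: "dim_vec x dvd T" "dim_vec y dvd T"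
    using assms(3,4) by (metis dvd_triv_left)+
  have a: "T div dim_vec x = a"
    unfolding assms(3) [symmetric] using assms(1) by (simp add: all_vecs_def)
  have b: "T div dim_vec y = b"
    unfolding assms(4) [symmetric] using assms(2) by (simp add: all_vecs_def)
  show ?thesis
    unfolding V_dist_common_multiple[OF assms(1,2,5) dv] a b
    using assms(3,4) by (intro arg_cong2[where f = "(/)"] L2_set_cong refl)
      (simp add: stretch_vec_index)
qed

definition frobenius_norm :: "real mat \<Rightarrow> real" where
  "frobenius_norm A = sqrt (\<Sum>i<dim_row A. \<Sum>j<dim_col A. (A $$ (i, j))\<^sup>2)"

text \<open>Grouping the coordinates of \<open>z\<close> by their residues modulo \<open>k\<close> splits it into \<open>k\<close> vectors on
  each of which \<open>A\<close> acts separately; the Cauchy-Schwarz inequality applies to each of them, and the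
  bounds add up.\<close>

lemma L2_set_stretch_mat_le:
  assumes "dim_vec z = dim_col A * k"
  shows "L2_set (\<lambda>i. (stretch_mat A k *\<^sub>v z) $ i) {..<dim_row A * k}
    \<le> frobenius_norm A * L2_set (\<lambda>l. z $ l) {..<dim_col A * k}"
proof -
  let ?m = "dim_row A" and ?n = "dim_col A"
  let ?z = "\<lambda>j b. (z $ (j * k + b))\<^sup>2"
  have "(\<Sum>i<?m * k. ((stretch_mat A k *\<^sub>v z) $ i)\<^sup>2)
      = (\<Sum>i<?m * k. (\<Sum>j<?n. A $$ (i div k, j) * z $ (j * k + i mod k))\<^sup>2)"
    using assms by (intro sum.cong refl) (simp add: stretch_mat_mult_vec_index del: index_mult_mat_vec)
  also have "\<dots> = (\<Sum>a<?m. \<Sum>b<k. (\<Sum>j<?n. A $$ (a, j) * z $ (j * k + b))\<^sup>2)"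
    by (rule sum_div_mod)
  also have "\<dots> \<le> (\<Sum>a<?m. \<Sum>b<k. (\<Sum>j<?n. (A $$ (a, j))\<^sup>2) * (\<Sum>j<?n. ?z j b))"
    by (intro sum_mono Cauchy_Schwarz_ineq_sum)
  also have "\<dots> = (\<Sum>a<?m. \<Sum>j<?n. (A $$ (a, j))\<^sup>2) * (\<Sum>j<?n. \<Sum>b<k. ?z j b)"
    by (subst sum.swap[of "\<lambda>j b. ?z j b"]) (simp add: sum_product)
  also have "(\<Sum>j<?n. \<Sum>b<k. ?z j b) = (\<Sum>l<?n * k. (z $ l)\<^sup>2)"
    by (subst sum_div_mod [symmetric]) simp
  finally show ?thesis
    unfolding L2_set_def frobenius_norm_def real_sqrt_mult [symmetric]
    by (rule real_sqrt_le_mono)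
qed

text \<open>Any common multiple of the two dimensions may replace the least one, at the price of
  stretching the result. In this way the images of two vectors can be computed with the same
  stretch of \<open>A\<close>, where linearity applies.\<close>

lemma stretch_vec_V_product:
  assumes "A \<in> all_mats" "x \<in> all_vecs" "dim_col A * k = dim_vec x * l"
  defines "t \<equiv> lcm (dim_col A) (dim_vec x)"
  shows "stretch_vec (V_product A x) (dim_col A * k div t) = stretch_mat A k *\<^sub>v stretch_vec x l"
    and "dim_vec (V_product A x) * (dim_col A * k div t) = dim_row A * k"
proof -
  have pos: "dim_col A > 0" "dim_vec x > 0" using assms by (auto simp: all_mats_def all_vecs_def)
  have "dim_vec x dvd dim_col A * k" by (simp add: assms(3))
  then have "t dvd dim_col A * k" unfolding t_def by simp
  then obtain s where s: "dim_col A * k = t * s" by blast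
  have t: "t > 0" using pos by (simp add: t_def lcm_pos_nat)
  then have s': "dim_col A * k div t = s" using s by simp
  have "dim_col A * k = dim_col A * (t div dim_col A * s)"
    unfolding s mult.assoc [symmetric] by (simp add: t_def)
  then have k: "k = t div dim_col A * s" using pos by simp
  have "dim_vec x * l = dim_vec x * (t div dim_vec x * s)"
    unfolding assms(3) [symmetric] s mult.assoc [symmetric] by (simp add: t_def)
  moreover have "dim_vec x \<noteq> 0" using pos by linarith
  ultimately have l: "l = t div dim_vec x * s" using mult_left_cancel by blast
  show "stretch_vec (V_product A x) (dim_col A * k div t) = stretch_mat A k *\<^sub>v stretch_vec x l"
    unfolding s'
    by (simp add: V_product_def Let_def stretch_mat_mult_vec stretch_mat_stretch
        stretch_vec_stretch k l t_def)
  show "dim_vec (V_product A x) * (dim_col A * k div t) = dim_row A * k"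
    unfolding s' by (simp add: k t_def)
qed

text \<open>Distances are normalised by the dimension. The factor \<open>sqrt (dim_col A / dim_row A)\<close>
  accounts for the passage from dimension \<open>dim_col A * k\<close> to \<open>dim_row A * k\<close>; the auxiliary \<open>k\<close>
  cancels.\<close>

lemma V_product_lipschitz:
  assumes A: "A \<in> all_mats" and x: "x \<in> all_vecs" and y: "y \<in> all_vecs"
  shows "V_dist (V_product A x) (V_product A y)
    \<le> frobenius_norm A * sqrt (dim_col A / dim_row A) * V_dist x y"
proof -
  let ?m = "dim_row A" and ?n = "dim_col A"
  define k where "k = dim_vec x * dim_vec y"
  define a where "a = ?n * dim_vec y"
  define b where "b = ?n * dim_vec x"
  have pos: "?m > 0" "?n > 0" "dim_vec x > 0" "dim_vec y > 0" "k > 0"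
    using assms by (auto simp: all_mats_def all_vecs_def k_def)
  have ka: "?n * k = dim_vec x * a" and kb: "?n * k = dim_vec y * b"
    by (simp_all add: k_def a_def b_def)
  let ?z = "stretch_vec x a - stretch_vec y b"
  have z: "dim_vec ?z = ?n * k" using kb by simp
  have "stretch_mat A k \<in> carrier_mat (?m * k) (?n * k)"
    "stretch_vec x a \<in> carrier_vec (?n * k)" "stretch_vec y b \<in> carrier_vec (?n * k)"
    using ka kb by (auto intro: carrier_matI carrier_vecI)
  then have lin: "stretch_mat A k *\<^sub>v ?z
      = stretch_mat A k *\<^sub>v stretch_vec x a - stretch_mat A k *\<^sub>v stretch_vec y b"
    by (rule mult_minus_distrib_mat_vec)
  have "V_dist x y
      = L2_set (\<lambda>l. stretch_vec x a $ l - stretch_vec y b $ l) {..<?n * k} / sqrt (real (?n * k))"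
    using pos by (intro V_dist_stretch[OF x y ka[symmetric] kb[symmetric]]) simp
  also have "L2_set (\<lambda>l. stretch_vec x a $ l - stretch_vec y b $ l) {..<?n * k}
      = L2_set (\<lambda>l. ?z $ l) {..<?n * k}"
    using kb by (intro L2_set_cong refl) simp
  finally have dist_xy: "V_dist x y = L2_set (\<lambda>l. ?z $ l) {..<?n * k} / sqrt (real (?n * k))" .
  have "V_dist (V_product A x) (V_product A y)
      = L2_set (\<lambda>i. (stretch_mat A k *\<^sub>v stretch_vec x a) $ i
          - (stretch_mat A k *\<^sub>v stretch_vec y b) $ i) {..<?m * k} / sqrt (real (?m * k))"
    using V_dist_stretch[OF V_product_closed[OF A x] V_product_closed[OF A y]
        stretch_vec_V_product(2)[OF A x ka] stretch_vec_V_product(2)[OF A y kb]] pos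
    by (simp add: stretch_vec_V_product(1)[OF A x ka] stretch_vec_V_product(1)[OF A y kb])
  also have "L2_set (\<lambda>i. (stretch_mat A k *\<^sub>v stretch_vec x a) $ i
          - (stretch_mat A k *\<^sub>v stretch_vec y b) $ i) {..<?m * k}
      = L2_set (\<lambda>i. (stretch_mat A k *\<^sub>v ?z) $ i) {..<?m * k}"
    unfolding lin by (intro L2_set_cong refl) (simp del: index_mult_mat_vec)
  also have "\<dots> / sqrt (real (?m * k))
      \<le> frobenius_norm A * L2_set (\<lambda>l. ?z $ l) {..<?n * k} / sqrt (real (?m * k))"
    by (intro divide_right_mono L2_set_stretch_mat_le z) simp
  also have "\<dots> = frobenius_norm A * sqrt (?n / ?m) * V_dist x y"
    unfolding dist_xy using pos by (simp add: real_sqrt_mult real_sqrt_divide field_simps)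
  finally show ?thesis .
qed

lemma openin_V_topology_iff:
  "openin V_topology U \<longleftrightarrow> U \<subseteq> all_vecs \<and> (\<forall>x\<in>U. \<exists>r>0. V_ball x r \<subseteq> U)"
proof
  assume "openin V_topology U"
  then have U: "\<exists>B. is_V_ball B \<and> x \<in> B \<and> B \<subseteq> U" if "x \<in> U" for x
    using that by (auto simp: openin_V_topology arbitrary_union_of_alt)
  show "U \<subseteq> all_vecs \<and> (\<forall>x\<in>U. \<exists>r>0. V_ball x r \<subseteq> U)"
  proof (intro conjI ballI)
    show "U \<subseteq> all_vecs" using U by (fastforce simp: is_V_ball_def V_ball_def)
  next
    fix x assume "x \<in> U"
    then obtain c s where c: "c \<in> all_vecs" "x \<in> V_ball c s" "V_ball c s \<subseteq> U"
      using U by (metis is_V_ball_def)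
    then have "V_ball x (s - V_dist c x) \<subseteq> V_ball c s"
      using V_dist_triangle[of c x] by (fastforce simp: V_ball_def)
    then show "\<exists>r>0. V_ball x r \<subseteq> U"
      using c by (intro exI[of _ "s - V_dist c x"]) (auto simp: V_ball_def)
  qed
next
  assume U: "U \<subseteq> all_vecs \<and> (\<forall>x\<in>U. \<exists>r>0. V_ball x r \<subseteq> U)"
  have "\<exists>B. is_V_ball B \<and> x \<in> B \<and> B \<subseteq> U" if x: "x \<in> U" for x
  proof -
    obtain r where "r > 0" "V_ball x r \<subseteq> U" using U x by blast
    moreover have "x \<in> V_ball x r" using U x \<open>r > 0\<close> by (auto simp: V_ball_def V_dist_self)
    ultimately show ?thesis using U x by (auto simp: is_V_ball_def)
  qed
  then show "openin V_topology U"
    by (auto simp: openin_V_topology arbitrary_union_of_alt)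
qed

lemma topspace_V_topology: "topspace V_topology = all_vecs"
proof
  show "topspace V_topology \<subseteq> all_vecs"
    using openin_topspace[of V_topology] unfolding openin_V_topology_iff by blast
  have "openin V_topology all_vecs"
    unfolding openin_V_topology_iff by (auto simp: V_ball_def intro: exI[of _ 1])
  then show "all_vecs \<subseteq> topspace V_topology" by (rule openin_subset)
qed

lemma continuous_map_V_lipschitz:
  assumes f: "\<And>x. x \<in> all_vecs \<Longrightarrow> f x \<in> all_vecs"
    and K: "\<And>x y. x \<in> all_vecs \<Longrightarrow> y \<in> all_vecs \<Longrightarrow> V_dist (f x) (f y) \<le> K * V_dist x y"
  shows "continuous_map V_topology V_topology f"
  unfolding continuous_map_def topspace_V_topology
proof (intro conjI allI impI)
  show "f \<in> all_vecs \<rightarrow> all_vecs" using f by blast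
next
  fix U assume U: "openin V_topology U"
  show "openin V_topology {x \<in> all_vecs. f x \<in> U}"
    unfolding openin_V_topology_iff
  proof (intro conjI ballI)
    fix x assume x: "x \<in> {x \<in> all_vecs. f x \<in> U}"
    then obtain r where r: "r > 0" "V_ball (f x) r \<subseteq> U"
      using U unfolding openin_V_topology_iff by blast
    \<comment> \<open>adding 1 keeps the radius well defined and positive for every constant \<open>K\<close>\<close>
    define s where "s = r / (\<bar>K\<bar> + 1)"
    have "V_ball x s \<subseteq> {x \<in> all_vecs. f x \<in> U}"
    proof
      fix y assume "y \<in> V_ball x s"
      then have y: "y \<in> all_vecs" "V_dist x y < s" by (auto simp: V_ball_def)
      have nonneg: "V_dist x y \<ge> 0"
        using x y(1) by (simp add: V_dist_lcm sum_nonneg)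
      have "V_dist (f x) (f y) \<le> K * V_dist x y" using K x y by blast
      also have "\<dots> \<le> (\<bar>K\<bar> + 1) * V_dist x y"
        using nonneg by (intro mult_right_mono) auto
      also have "\<dots> < (\<bar>K\<bar> + 1) * s"
        using y by (intro mult_strict_left_mono) auto
      also have "\<dots> = r" by (simp add: s_def add_nonneg_eq_0_iff)
      finally show "y \<in> {x \<in> all_vecs. f x \<in> U}"
        using r y f by (auto simp: V_ball_def)
    qed
    moreover have "s > 0" using r by (simp add: s_def)
    ultimately show "\<exists>r>0. V_ball x r \<subseteq> {x \<in> all_vecs. f x \<in> U}" by blast
  qed auto
qed

theorem mainTheorem4:
  shows "pseudo_dynamic_system M_monoid V_product all_vecs V_topology"
proof unfold_locales
  have "0\<^sub>v 1 \<in> all_vecs" by (simp add: all_vecs_def)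
  then show "all_vecs \<noteq> {}" by blast
  show "topspace V_topology = all_vecs" by (rule topspace_V_topology)
  show "continuous_map V_topology V_topology (V_product A)" if "A \<in> carrier M_monoid" for A
  proof -
    have A: "A \<in> all_mats" using that by (simp add: M_monoid_def)
    show ?thesis
      by (rule continuous_map_V_lipschitz[OF V_product_closed[OF A] V_product_lipschitz[OF A]])
  qed
next
  show "\<one>\<^bsub>M_monoid\<^esub> \<in> carrier M_monoid" by (simp add: M_monoid_def all_mats_def)
qed (simp_all add: M_monoid_def M_product_closed M_product_assoc M_product_one_left
      M_product_one_right V_product_closed V_product_assoc V_product_one del: One_nat_def)

end
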